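(* Let $\mathcal{C}$ be a cloud. For $X\in\mathcal{C}$ let $\Lambda_X$ be the set of all real $\lambda>0$ such that $\lambda X\in\mathcal{C}$. Then $\Lambda_X$ does not depend on the choice of $X\in\mathcal{C}$, i.e., $\Lambda_X=\Lambda_Y$ for all $X,Y\in\mathcal{C}$.
   Context: $\mathcal{GH}$ denotes the proper class of all non-empty metric spaces considered up to isometry (no compactness or boundedness assumed). The Gromov--Hausdorff distance $d_{GH}(X,Y)\in[0,\infty]$ is the infimum of the Hausdorff distances $d_H(X',Y')$ over all metric spaces $Z$ and all subsets $X',Y'\subset Z$ isometric to $X$ and $Y$ respectively; it is a generalized pseudometric (the value $\infty$ is allowed). A cloud is an equivalence class of the relation $d_{GH}(X,Y)<\infty$ on $\mathcal{GH}$. For a metric space $X$ and real $\lambda>0$, $\lambda X$ is the metric space obtained from $X$ by multiplying all distances by $\lambda$. *)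

theory Defs
  imports "HOL-Analysis.Analysis"
begin

definition isometric :: "'a metric \<Rightarrow> 'b metric \<Rightarrow> bool" where
  "isometric X Y \<longleftrightarrow> (\<exists>f. bij_betw f (mspace X) (mspace Y) \<and>
     (\<forall>x\<in>mspace X. \<forall>x'\<in>mspace X. mdist Y (f x) (f x') = mdist X x x'))"

definition hausdorff_dist :: "'a metric \<Rightarrow> 'a set \<Rightarrow> 'a set \<Rightarrow> ennreal" where
  "hausdorff_dist Z A B =
     max (SUP a\<in>A. INF b\<in>B. ennreal (mdist Z a b)) (SUP b\<in>B. INF a\<in>A. ennreal (mdist Z a b))"

text \<open>
  In the Gromov--Hausdorff distance the ambient space \<open>Z\<close> ranges over all metric spaces.  A
  definition in HOL cannot quantify over types, so \<open>Z\<close> ranges over all metric spaces carried by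
  subsets of \<^typ>\<open>'a + 'b\<close>.  This loses nothing, because \<open>Z\<close> may be replaced by its subspace
  \<open>X' \<union> Y'\<close>; see \<open>gh_dist_le\<close> below, where the ambient type is arbitrary.
\<close>

definition gh_dist :: "'a metric \<Rightarrow> 'b metric \<Rightarrow> ennreal" where
  "gh_dist X Y = Inf {hausdorff_dist Z X' Y' | (Z :: ('a + 'b) metric) X' Y'.
     X' \<subseteq> mspace Z \<and> Y' \<subseteq> mspace Z \<and> isometric (submetric Z X') X \<and> isometric (submetric Z Y') Y}"

lemma gh_dist_le:
  fixes X :: "'a metric" and Y :: "'b metric" and Z :: "'z metric"
  assumes "X' \<subseteq> mspace Z" "Y' \<subseteq> mspace Z"
    and "isometric (submetric Z X') X" "isometric (submetric Z Y') Y"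
  shows "gh_dist X Y \<le> hausdorff_dist Z X' Y'"
proof -
  have int: "X' \<inter> mspace Z = X'" "Y' \<inter> mspace Z = Y'" using assms by auto
  obtain f where f: "bij_betw f X' (mspace X)"
      "\<And>x x'. x \<in> X' \<Longrightarrow> x' \<in> X' \<Longrightarrow> mdist X (f x) (f x') = mdist Z x x'"
    using assms(3) int by (auto simp: isometric_def)
  obtain g where g: "bij_betw g Y' (mspace Y)"
      "\<And>x x'. x \<in> Y' \<Longrightarrow> x' \<in> Y' \<Longrightarrow> mdist Y (g x) (g x') = mdist Z x x'"
    using assms(4) int by (auto simp: isometric_def)
  define U where "U = X' \<union> Y'"
  define e :: "'z \<Rightarrow> 'a + 'b" where "e z = (if z \<in> X' then Inl (f z) else Inr (g z))" for z
  define i where "i = inv_into U e"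
  define W where "W = metric (e ` U, \<lambda>u v. mdist Z (i u) (i v))"
  have inj: "inj_on e U"
    using f(1) g(1) by (auto simp: inj_on_def e_def U_def bij_betw_def split: if_splits)
  have ie: "i (e z) = z" if "z \<in> U" for z
    using inj that by (simp add: i_def)
  have UZ: "U \<subseteq> mspace Z" using assms by (auto simp: U_def)
  interpret Z: Metric_space "mspace Z" "mdist Z" by simp
  interpret W: Metric_space "e ` U" "\<lambda>u v. mdist Z (i u) (i v)"
    using UZ by unfold_locales (auto simp: ie Z.commute subset_iff intro!: Z.triangle)
  have W: "mspace W = e ` U" "mdist W = (\<lambda>u v. mdist Z (i u) (i v))"
    by (simp_all add: W_def)
  have sub: "isometric (submetric W (e ` S)) V"
    if S: "S \<subseteq> U" and h: "bij_betw h S (mspace V)"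
      "\<And>x x'. x \<in> S \<Longrightarrow> x' \<in> S \<Longrightarrow> mdist V (h x) (h x') = mdist Z x x'"
    for S and h :: "'z \<Rightarrow> 'v" and V :: "'v metric"
  proof -
    have S': "e ` S \<inter> e ` U = e ` S" using S by auto
    have "bij_betw i (e ` S) S"
      using S by (intro bij_betw_byWitness[where f' = e]) (auto simp: ie subsetD)
    then have "bij_betw (h \<circ> i) (e ` S) (mspace V)" using h(1) by (rule bij_betw_trans)
    then show ?thesis
      unfolding isometric_def using S h(2) by (intro exI[of _ "h \<circ> i"]) (auto simp: W S' ie subsetD)
  qed
  have "isometric (submetric W (e ` X')) X" "isometric (submetric W (e ` Y')) Y"
    using f g by (auto intro!: sub simp: U_def)
  moreover have "e ` X' \<subseteq> mspace W" "e ` Y' \<subseteq> mspace W" by (auto simp: W U_def)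
  moreover have "hausdorff_dist W (e ` X') (e ` Y') = hausdorff_dist Z X' Y'"
    by (simp add: hausdorff_dist_def W image_image ie U_def)
  ultimately have "hausdorff_dist Z X' Y' \<in> {hausdorff_dist Z X' Y' | (Z :: ('a + 'b) metric) X' Y'.
     X' \<subseteq> mspace Z \<and> Y' \<subseteq> mspace Z \<and> isometric (submetric Z X') X \<and> isometric (submetric Z Y') Y}"
    by (smt (verit, best) mem_Collect_eq)
  then show ?thesis unfolding gh_dist_def by (rule Inf_lower)
qed

text \<open>
  A cloud is a proper class, so it is given by a representative \<open>Z\<close>: \<open>cloud Z\<close> is the part of the
  equivalence class of \<open>Z\<close> consisting of the spaces whose points lie in \<^typ>\<open>'a\<close>.  It is
  polymorphic in \<^typ>\<open>'a\<close>, which need not be the type of the points of \<open>Z\<close>.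
\<close>

definition cloud :: "'z metric \<Rightarrow> 'a metric set" where
  "cloud Z = {X. mspace X \<noteq> {} \<and> gh_dist Z X < \<infinity>}"

definition scale_metric :: "real \<Rightarrow> 'a metric \<Rightarrow> 'a metric" where
  "scale_metric l X = metric (mspace X, \<lambda>x y. l * mdist X x y)"

lemma scale_metric_simps [simp]:
  assumes "l > 0"
  shows "mspace (scale_metric l X) = mspace X"
    and "mdist (scale_metric l X) = (\<lambda>x y. l * mdist X x y)"
proof -
  interpret X: Metric_space "mspace X" "mdist X" by simp
  have "l * mdist X x z \<le> l * mdist X x y + l * mdist X y z"
    if "x \<in> mspace X" "y \<in> mspace X" "z \<in> mspace X" for x y z
    using X.triangle[OF that] assms by (metis distrib_left mult_le_cancel_left_pos)
  then interpret S: Metric_space "mspace X" "\<lambda>x y. l * mdist X x y"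
    using assms by unfold_locales (auto simp: X.commute)
  show "mspace (scale_metric l X) = mspace X"
    and "mdist (scale_metric l X) = (\<lambda>x y. l * mdist X x y)"
    by (simp_all add: scale_metric_def)
qed

definition Lambda :: "'z metric \<Rightarrow> 'a metric \<Rightarrow> real set" where
  "Lambda Z X = {l. l > 0 \<and> scale_metric l X \<in> cloud Z}"

end

theory Submission
  imports Defs
begin

text \<open>
  Finite Gromov--Hausdorff distance between non-empty spaces means the existence of a rough isometry:
  a map that distorts distances by at most a constant and whose image is coarsely dense.  Rough
  isometries compose, have rough inverses and remain rough isometries after both spaces are scaled
  by the same factor.  So if \<open>X\<close>, \<open>Y\<close> and \<open>\<lambda>X\<close> lie in one cloud, then \<open>\<lambda>Y\<close> is
  roughly isometric to \<open>\<lambda>X\<close> and lies in it too.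
\<close>

section \<open>Rough isometries: inverses, composition and scaling\<close>

text \<open>Strict positivity of \<open>C\<close> serves the gluing construction below, where
  \<open>C\<close> separates the two copies; this keeps distances between distinct points
  positive.\<close>

definition rough_isometry :: "real \<Rightarrow> 'a metric \<Rightarrow> 'b metric \<Rightarrow> ('a \<Rightarrow> 'b) \<Rightarrow> bool" where
  "rough_isometry C X Y f \<longleftrightarrow> C > 0 \<and> f \<in> mspace X \<rightarrow> mspace Y \<and>
     (\<forall>x\<in>mspace X. \<forall>x'\<in>mspace X. \<bar>mdist Y (f x) (f x') - mdist X x x'\<bar> \<le> C) \<and>
     (\<forall>y\<in>mspace Y. \<exists>x\<in>mspace X. mdist Y (f x) y \<le> C)"

definition roughly_isometric :: "'a metric \<Rightarrow> 'b metric \<Rightarrow> bool" where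
  "roughly_isometric X Y \<longleftrightarrow> (\<exists>C f. rough_isometry C X Y f)"

text \<open>Enlarging \<open>C\<close> to \<open>max C 1\<close> secures positivity, so constants
  that are zero or of unknown sign may be supplied.\<close>

lemma roughly_isometricI:
  assumes "\<And>x. x \<in> mspace X \<Longrightarrow> f x \<in> mspace Y"
    and "\<And>x x'. x \<in> mspace X \<Longrightarrow> x' \<in> mspace X \<Longrightarrow> \<bar>mdist Y (f x) (f x') - mdist X x x'\<bar> \<le> C"
    and "\<And>y. y \<in> mspace Y \<Longrightarrow> \<exists>x\<in>mspace X. mdist Y (f x) y \<le> C"
  shows "roughly_isometric X Y"
proof -
  have "rough_isometry (max C 1) X Y f"
    unfolding rough_isometry_def using assms by (fastforce simp: le_max_iff_disj)
  then show ?thesis unfolding roughly_isometric_def by blast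
qed

text \<open>A rough inverse \<open>g\<close> chooses for each \<open>y\<close> a point whose image
  under \<open>f\<close> is within \<open>C\<close> of \<open>y\<close>.\<close>

lemma roughly_isometric_sym:
  assumes "roughly_isometric X Y"
  shows "roughly_isometric Y X"
proof -
  obtain C f where f: "f \<in> mspace X \<rightarrow> mspace Y"
      "\<And>x x'. x \<in> mspace X \<Longrightarrow> x' \<in> mspace X \<Longrightarrow> \<bar>mdist Y (f x) (f x') - mdist X x x'\<bar> \<le> C"
      "\<And>y. y \<in> mspace Y \<Longrightarrow> \<exists>x\<in>mspace X. mdist Y (f x) y \<le> C"
    using assms unfolding roughly_isometric_def rough_isometry_def by blast
  obtain g where g: "\<And>y. y \<in> mspace Y \<Longrightarrow> g y \<in> mspace X" "\<And>y. y \<in> mspace Y \<Longrightarrow> mdist Y (f (g y)) y \<le> C"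
    using f(3) by metis
  interpret Y: Metric_space "mspace Y" "mdist Y" by simp
  show ?thesis
  \<comment> \<open>One \<open>C\<close> is the distortion of \<open>f\<close>; the other two pay
    for replacing \<open>y\<close> and \<open>y'\<close> by \<open>f (g y)\<close> and
    \<open>f (g y')\<close>.\<close>
  proof (rule roughly_isometricI[of Y g X "3 * C"])
    fix y y' assume y: "y \<in> mspace Y" "y' \<in> mspace Y"
    let ?u = "f (g y)" and ?u' = "f (g y')"
    have u: "?u \<in> mspace Y" "?u' \<in> mspace Y" using f(1) g(1) y by auto
    have "mdist Y ?u ?u' \<le> mdist Y ?u y + mdist Y y y' + mdist Y y' ?u'"
      using Y.triangle[OF u(1) y(1) u(2)] Y.triangle[OF y u(2)] by linarith
    moreover have "mdist Y y y' \<le> mdist Y y ?u + mdist Y ?u ?u' + mdist Y ?u' y'"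
      using Y.triangle[OF y(1) u(1) y(2)] Y.triangle[OF u(1) u(2) y(2)] by linarith
    ultimately show "\<bar>mdist X (g y) (g y') - mdist Y y y'\<bar> \<le> 3 * C"
      using f(2)[OF g(1)[OF y(1)] g(1)[OF y(2)]] g(2)[OF y(1)] g(2)[OF y(2)]
        Y.commute[of y ?u] Y.commute[of y' ?u'] by linarith
  next
    fix x assume x: "x \<in> mspace X"
    then have fx: "f x \<in> mspace Y" using f(1) by auto
    have "mdist X (g (f x)) x \<le> 2 * C"
      using f(2)[OF g(1)[OF fx] x] g(2)[OF fx] by linarith
    \<comment> \<open>\<open>C\<close> bounds a distance, hence is nonnegative, and so 2C \<le>
      3C.\<close>
    then show "\<exists>y\<in>mspace Y. mdist X (g y) x \<le> 3 * C"
      using fx order_trans[OF Y.nonneg g(2)[OF fx]] by force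
  qed (rule g(1))
qed

lemma roughly_isometric_trans:
  assumes "roughly_isometric X Y" "roughly_isometric Y V"
  shows "roughly_isometric X V"
proof -
  obtain C f where f: "f \<in> mspace X \<rightarrow> mspace Y"
      "\<And>x x'. x \<in> mspace X \<Longrightarrow> x' \<in> mspace X \<Longrightarrow> \<bar>mdist Y (f x) (f x') - mdist X x x'\<bar> \<le> C"
      "\<And>y. y \<in> mspace Y \<Longrightarrow> \<exists>x\<in>mspace X. mdist Y (f x) y \<le> C" "C > 0"
    using assms(1) unfolding roughly_isometric_def rough_isometry_def by blast
  obtain D g where g: "g \<in> mspace Y \<rightarrow> mspace V"
      "\<And>x x'. x \<in> mspace Y \<Longrightarrow> x' \<in> mspace Y \<Longrightarrow> \<bar>mdist V (g x) (g x') - mdist Y x x'\<bar> \<le> D"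
      "\<And>y. y \<in> mspace V \<Longrightarrow> \<exists>x\<in>mspace Y. mdist V (g x) y \<le> D" "D > 0"
    using assms(2) unfolding roughly_isometric_def rough_isometry_def by blast
  interpret V: Metric_space "mspace V" "mdist V" by simp
  show ?thesis
  \<comment> \<open>The distortions add up to \<open>C + D\<close>. Coarse density needs one more
    \<open>D\<close>: \<open>g (f x)\<close> is within \<open>C + D\<close> of \<open>g y\<close>,
    which is within \<open>D\<close> of \<open>v\<close>.\<close>
  proof (rule roughly_isometricI[of X "g \<circ> f" V "C + 2 * D"])
    fix x x' assume x: "x \<in> mspace X" "x' \<in> mspace X"
    then have "f x \<in> mspace Y" "f x' \<in> mspace Y" using f(1) by auto
    from g(2)[OF this] f(2)[OF x] g(4)
    show "\<bar>mdist V ((g \<circ> f) x) ((g \<circ> f) x') - mdist X x x'\<bar> \<le> C + 2 * D" by simp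
  next
    fix v assume v: "v \<in> mspace V"
    obtain y where y: "y \<in> mspace Y" "mdist V (g y) v \<le> D" using g(3)[OF v] by blast
    obtain x where x: "x \<in> mspace X" "mdist Y (f x) y \<le> C" using f(3)[OF y(1)] by blast
    have fx: "f x \<in> mspace Y" using f(1) x by auto
    have "mdist V (g (f x)) v \<le> mdist V (g (f x)) (g y) + mdist V (g y) v"
      using V.triangle g(1) fx y(1) v by blast
    then have "mdist V (g (f x)) v \<le> C + 2 * D" using g(2)[OF fx y(1)] x(2) y(2) by linarith
    then show "\<exists>x\<in>mspace X. mdist V ((g \<circ> f) x) v \<le> C + 2 * D" using x(1) by auto
  qed (use f(1) g(1) in auto)
qed

lemma roughly_isometric_scale:
  assumes "roughly_isometric X Y" "l > 0"
  shows "roughly_isometric (scale_metric l X) (scale_metric l Y)"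
proof -
  obtain C f where f: "f \<in> mspace X \<rightarrow> mspace Y"
      "\<And>x x'. x \<in> mspace X \<Longrightarrow> x' \<in> mspace X \<Longrightarrow> \<bar>mdist Y (f x) (f x') - mdist X x x'\<bar> \<le> C"
      "\<And>y. y \<in> mspace Y \<Longrightarrow> \<exists>x\<in>mspace X. mdist Y (f x) y \<le> C"
    using assms(1) unfolding roughly_isometric_def rough_isometry_def by blast
  have "\<bar>l * mdist Y (f x) (f x') - l * mdist X x x'\<bar> \<le> l * C"
    if "x \<in> mspace X" "x' \<in> mspace X" for x x'
    using f(2)[OF that] \<open>l > 0\<close> by (simp add: right_diff_distrib[symmetric] abs_mult)
  with f(1,3) \<open>l > 0\<close> show ?thesis
    by (intro roughly_isometricI[of _ f _ "l * C"]) auto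
qed

section \<open>From finite Gromov--Hausdorff distance to a rough isometry\<close>

lemma hausdorff_dist_less_top_imp:
  assumes "hausdorff_dist Z A B < \<infinity>"
  obtains D where "\<And>a. a \<in> A \<Longrightarrow> \<exists>b\<in>B. mdist Z a b \<le> D"
    "\<And>b. b \<in> B \<Longrightarrow> \<exists>a\<in>A. mdist Z a b \<le> D"
proof -
  \<comment> \<open>The infima need not be attained, so \<open>r\<close> is taken strictly above the
    Hausdorff distance; then some point lies within \<open>r\<close>.\<close>
  obtain r where r: "hausdorff_dist Z A B < ennreal r" "r > 0"
  proof -
    obtain s where "hausdorff_dist Z A B = ennreal s" "s \<ge> 0"
      using assms by (cases "hausdorff_dist Z A B") auto
    then show ?thesis using that[of "s + 1"] by (simp add: ennreal_less_iff)
  qed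
  have "\<exists>b\<in>B. mdist Z a b \<le> r" if "a \<in> A" for a
  proof -
    have "(INF b\<in>B. ennreal (mdist Z a b)) < ennreal r"
      using r(1) that unfolding hausdorff_dist_def by (meson SUP_upper max.cobounded1 order_trans le_less_trans)
    then show ?thesis using r(2) by (force simp: INF_less_iff ennreal_less_iff)
  qed
  moreover have "\<exists>a\<in>A. mdist Z a b \<le> r" if "b \<in> B" for b
  proof -
    have "(INF a\<in>A. ennreal (mdist Z a b)) < ennreal r"
      using r(1) that unfolding hausdorff_dist_def by (meson SUP_upper max.cobounded2 order_trans le_less_trans)
    then show ?thesis using r(2) by (force simp: INF_less_iff ennreal_less_iff)
  qed
  ultimately show ?thesis using that by blast
qed

text \<open>A choice \<open>h\<close> of nearby points moves each point of \<open>A\<close> by at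
  most \<open>D\<close>. Hence it changes distances by at most 2D, and a point of \<open>B\<close>
  within \<open>D\<close> of \<open>a\<close> is within 2D of \<open>h a\<close>.\<close>

lemma roughly_isometric_if_hausdorff_dist_less_top:
  assumes "hausdorff_dist Z A B < \<infinity>" "A \<subseteq> mspace Z" "B \<subseteq> mspace Z"
  shows "roughly_isometric (submetric Z A) (submetric Z B)"
proof -
  obtain D where D: "\<And>a. a \<in> A \<Longrightarrow> \<exists>b\<in>B. mdist Z a b \<le> D" "\<And>b. b \<in> B \<Longrightarrow> \<exists>a\<in>A. mdist Z a b \<le> D"
    using hausdorff_dist_less_top_imp[OF assms(1)] by blast
  obtain h where h: "\<And>a. a \<in> A \<Longrightarrow> h a \<in> B" "\<And>a. a \<in> A \<Longrightarrow> mdist Z a (h a) \<le> D"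
    using D(1) by metis
  have ints: "A \<inter> mspace Z = A" "B \<inter> mspace Z = B" using assms by auto
  interpret Z: Metric_space "mspace Z" "mdist Z" by simp
  show ?thesis
  proof (rule roughly_isometricI[of _ h _ "2 * D"])
    fix a a' assume "a \<in> mspace (submetric Z A)" "a' \<in> mspace (submetric Z A)"
    then have a: "a \<in> A" "a' \<in> A" by auto
    have m: "a \<in> mspace Z" "a' \<in> mspace Z" "h a \<in> mspace Z" "h a' \<in> mspace Z"
      using a h(1) assms by auto
    have "mdist Z (h a) (h a') \<le> mdist Z (h a) a + mdist Z a a' + mdist Z a' (h a')"
      using Z.triangle[OF m(3,1,4)] Z.triangle[OF m(1,2,4)] by linarith
    moreover have "mdist Z a a' \<le> mdist Z a (h a) + mdist Z (h a) (h a') + mdist Z (h a') a'"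
      using Z.triangle[OF m(1,3,2)] Z.triangle[OF m(3,4,2)] by linarith
    ultimately show "\<bar>mdist (submetric Z B) (h a) (h a') - mdist (submetric Z A) a a'\<bar> \<le> 2 * D"
      using h(2)[OF a(1)] h(2)[OF a(2)] Z.commute[of a "h a"] Z.commute[of a' "h a'"] by simp
  next
    fix b assume "b \<in> mspace (submetric Z B)"
    then have b: "b \<in> B" by auto
    obtain a where a: "a \<in> A" "mdist Z a b \<le> D" using D(2)[OF b] by blast
    have m: "a \<in> mspace Z" "h a \<in> mspace Z" "b \<in> mspace Z" using a h(1) b assms by auto
    have "mdist Z (h a) b \<le> 2 * D"
      using Z.triangle[OF m(2,1,3)] h(2)[OF a(1)] a(2) Z.commute[of a "h a"] by linarith
    then show "\<exists>x\<in>mspace (submetric Z A). mdist (submetric Z B) (h x) b \<le> 2 * D"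
      using a(1) ints by auto
  qed (use h ints in auto)
qed

lemma isometric_imp_roughly_isometric:
  assumes "isometric X Y"
  shows "roughly_isometric X Y"
proof -
  obtain f where f: "bij_betw f (mspace X) (mspace Y)"
      "\<And>x x'. x \<in> mspace X \<Longrightarrow> x' \<in> mspace X \<Longrightarrow> mdist Y (f x) (f x') = mdist X x x'"
    using assms unfolding isometric_def by blast
  then have "\<exists>x\<in>mspace X. mdist Y (f x) y \<le> 0" if "y \<in> mspace Y" for y
    using that unfolding bij_betw_def by (metis imageE mdist_zero order_refl)
  with f show ?thesis
    by (intro roughly_isometricI[of X f Y 0]) (auto simp: bij_betw_def)
qed

text \<open>Some common ambient space realises a finite Hausdorff distance, and the chain X, A, B, Y
  consists of an isometry, the nearby-point map and another isometry.\<close>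

lemma roughly_isometric_if_gh_dist_less_top:
  fixes X :: "'a metric" and Y :: "'b metric"
  assumes "gh_dist X Y < \<infinity>"
  shows "roughly_isometric X Y"
proof -
  obtain Z :: "('a + 'b) metric" and A B where *: "hausdorff_dist Z A B < \<infinity>"
      "A \<subseteq> mspace Z" "B \<subseteq> mspace Z" "isometric (submetric Z A) X" "isometric (submetric Z B) Y"
    using assms unfolding gh_dist_def Inf_less_iff by blast
  show ?thesis
    using roughly_isometric_if_hausdorff_dist_less_top[OF *(1-3)] *(4,5)
    by (meson isometric_imp_roughly_isometric roughly_isometric_sym roughly_isometric_trans)
qed

section \<open>From a rough isometry to finite Gromov--Hausdorff distance, by gluing\<close>

text \<open>
  The summand \<open>C\<close> absorbs the distortion of \<open>f\<close> in the triangle inequality for paths that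
  cross from \<open>X\<close> to \<open>Y\<close> and back.
\<close>

definition bridge_dist :: "real \<Rightarrow> 'a metric \<Rightarrow> 'b metric \<Rightarrow> ('a \<Rightarrow> 'b) \<Rightarrow> 'a \<Rightarrow> 'b \<Rightarrow> real" where
  "bridge_dist C X Y f x y = (INF p\<in>mspace X. mdist X x p + C + mdist Y (f p) y)"

fun glue_dist :: "real \<Rightarrow> 'a metric \<Rightarrow> 'b metric \<Rightarrow> ('a \<Rightarrow> 'b) \<Rightarrow> 'a + 'b \<Rightarrow> 'a + 'b \<Rightarrow> real" where
  "glue_dist C X Y f (Inl x) (Inl x') = mdist X x x'"
| "glue_dist C X Y f (Inl x) (Inr y) = bridge_dist C X Y f x y"
| "glue_dist C X Y f (Inr y) (Inl x) = bridge_dist C X Y f x y"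
| "glue_dist C X Y f (Inr y) (Inr y') = mdist Y y y'"

lemma bridge_dist_le:
  assumes "C > 0" "p \<in> mspace X"
  shows "bridge_dist C X Y f x y \<le> mdist X x p + C + mdist Y (f p) y"
  unfolding bridge_dist_def
proof (rule cINF_lower[OF _ assms(2)])
  show "bdd_below ((\<lambda>p. mdist X x p + C + mdist Y (f p) y) ` mspace X)"
    using assms(1) by (intro bdd_belowI[of _ 0]) auto
qed

text \<open>Nonemptiness matters because the infimum of the empty set of reals carries no
  information.\<close>

lemma bridge_dist_ge:
  assumes "mspace X \<noteq> {}" "\<And>p. p \<in> mspace X \<Longrightarrow> c \<le> mdist X x p + C + mdist Y (f p) y"
  shows "c \<le> bridge_dist C X Y f x y"
  unfolding bridge_dist_def using assms by (intro cINF_greatest) auto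

text \<open>The triangle inequality splits by the sides on which the three points lie. Up to
  symmetry, \<open>t1\<close> and \<open>t2\<close> treat endpoints on opposite sides, while
  \<open>t3\<close> and \<open>t4\<close> treat endpoints on one side with a detour through the
  other.\<close>

lemma Metric_space_glue_dist:
  assumes f: "rough_isometry C X Y f" and "mspace X \<noteq> {}"
  shows "Metric_space (Inl ` mspace X \<union> Inr ` mspace Y) (glue_dist C X Y f)"
proof -
  interpret X: Metric_space "mspace X" "mdist X" by simp
  interpret Y: Metric_space "mspace Y" "mdist Y" by simp
  have C: "C > 0" and fY: "\<And>x. x \<in> mspace X \<Longrightarrow> f x \<in> mspace Y"
    and dis: "\<And>x x'. x \<in> mspace X \<Longrightarrow> x' \<in> mspace X \<Longrightarrow> \<bar>mdist Y (f x) (f x') - mdist X x x'\<bar> \<le> C"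
    using f unfolding rough_isometry_def by auto
  let ?B = "bridge_dist C X Y f"
  \<comment> \<open>Every term of the infimum is at least \<open>C\<close>, so points on different
    sides never have distance 0.\<close>
  have pos: "?B x y > 0" for x y
  proof -
    have "C \<le> ?B x y" using assms(2) by (intro bridge_dist_ge) auto
    with C show ?thesis by simp
  qed
  have t1: "?B x y \<le> mdist X x x' + ?B x' y" if "x \<in> mspace X" "x' \<in> mspace X" for x x' y
  proof -
    have "?B x y - mdist X x x' \<le> ?B x' y"
    proof (rule bridge_dist_ge)
      fix p assume p: "p \<in> mspace X"
      show "?B x y - mdist X x x' \<le> mdist X x' p + C + mdist Y (f p) y"
        using bridge_dist_le[OF C p, of Y f x y] X.triangle[OF that p] by linarith
    qed (use that in auto)
    then show ?thesis by simp
  qed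
  have t2: "?B x y \<le> ?B x y' + mdist Y y' y" if "x \<in> mspace X" "y \<in> mspace Y" "y' \<in> mspace Y" for x y y'
  proof -
    have "?B x y - mdist Y y' y \<le> ?B x y'"
    proof (rule bridge_dist_ge)
      fix p assume p: "p \<in> mspace X"
      show "?B x y - mdist Y y' y \<le> mdist X x p + C + mdist Y (f p) y'"
        using bridge_dist_le[OF C p, of Y f x y] Y.triangle[OF fY[OF p] that(3,2)] by linarith
    qed (use that in auto)
    then show ?thesis by simp
  qed
  \<comment> \<open>A sum of two infima is bounded below by bounding all pairs of crossing points
    \<open>p\<close>, \<open>q\<close>; the infima are removed one after the other.\<close>
  have sum_ge: "c \<le> ?B x y + ?B x' y'" if "x \<in> mspace X"
    "\<And>p q. p \<in> mspace X \<Longrightarrow> q \<in> mspace X \<Longrightarrow>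
       c \<le> (mdist X x p + C + mdist Y (f p) y) + (mdist X x' q + C + mdist Y (f q) y')" for c x x' y y'
  proof -
    have "c - ?B x' y' \<le> ?B x y"
    proof (rule bridge_dist_ge)
      fix p assume p: "p \<in> mspace X"
      have "c - (mdist X x p + C + mdist Y (f p) y) \<le> ?B x' y'"
      proof (rule bridge_dist_ge)
        fix q assume "q \<in> mspace X"
        from that(2)[OF p this]
        show "c - (mdist X x p + C + mdist Y (f p) y) \<le> mdist X x' q + C + mdist Y (f q) y'" by simp
      qed (use p in auto)
      then show "c - ?B x' y' \<le> mdist X x p + C + mdist Y (f p) y" by simp
    qed (use that in auto)
    then show ?thesis by simp
  qed
  have t3: "mdist X x x' \<le> ?B x y + ?B x' y"
    if "x \<in> mspace X" "x' \<in> mspace X" "y \<in> mspace Y" for x x' y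
  proof (rule sum_ge[OF that(1)])
    fix p q assume pq: "p \<in> mspace X" "q \<in> mspace X"
    \<comment> \<open>Go from \<open>x\<close> through \<open>p\<close> and \<open>q\<close> to
      \<open>x'\<close>. The middle leg is at most the distance from \<open>f p\<close> to
      \<open>f q\<close> plus \<open>C\<close>, and that distance is estimated through
      \<open>y\<close>. The two crossings supply 2C, which covers this \<open>C\<close>.\<close>
    show "mdist X x x' \<le> (mdist X x p + C + mdist Y (f p) y) + (mdist X x' q + C + mdist Y (f q) y)"
      using X.triangle[OF that(1) pq(1) that(2)] X.triangle[OF pq that(2)] X.commute[of x' q]
        Y.triangle[OF fY[OF pq(1)] that(3) fY[OF pq(2)]] Y.commute[of y "f q"] dis[OF pq] C
      by linarith
  qed
  have t4: "mdist Y y y' \<le> ?B x y + ?B x y'"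
    if "x \<in> mspace X" "y \<in> mspace Y" "y' \<in> mspace Y" for x y y'
  proof (rule sum_ge[OF that(1)])
    fix p q assume pq: "p \<in> mspace X" "q \<in> mspace X"
    \<comment> \<open>The mirror image: go through \<open>f p\<close> and \<open>f q\<close>, and
      compare the middle leg with the path from \<open>p\<close> through \<open>x\<close> to
      \<open>q\<close>, again losing only one \<open>C\<close>.\<close>
    show "mdist Y y y' \<le> (mdist X x p + C + mdist Y (f p) y) + (mdist X x q + C + mdist Y (f q) y')"
      using X.triangle[OF pq(1) that(1) pq(2)] X.commute[of x p] dis[OF pq] C Y.commute[of y "f p"]
        Y.triangle[OF that(2) fY[OF pq(1)] that(3)] Y.triangle[OF fY[OF pq(1)] fY[OF pq(2)] that(3)]
      by linarith
  qed
  show ?thesis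
  proof
    show "0 \<le> glue_dist C X Y f u v" for u v
      using pos by (cases u; cases v) (auto intro: less_imp_le)
    show "glue_dist C X Y f u v = glue_dist C X Y f v u" for u v
      by (cases u; cases v) (auto simp: X.commute Y.commute)
    show "glue_dist C X Y f u v = 0 \<longleftrightarrow> u = v"
      if "u \<in> Inl ` mspace X \<union> Inr ` mspace Y" "v \<in> Inl ` mspace X \<union> Inr ` mspace Y" for u v
      using that pos by (auto simp: less_imp_neq[THEN not_sym])
    show "glue_dist C X Y f u w \<le> glue_dist C X Y f u v + glue_dist C X Y f v w"
      if "u \<in> Inl ` mspace X \<union> Inr ` mspace Y" "v \<in> Inl ` mspace X \<union> Inr ` mspace Y"
        "w \<in> Inl ` mspace X \<union> Inr ` mspace Y" for u v w
      using that t1 t2 t3 t4 X.triangle Y.triangle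
      by (elim UnE imageE; simp) (metis add.commute X.commute Y.commute)+
  qed
qed

lemma hausdorff_dist_le:
  assumes "\<And>a. a \<in> A \<Longrightarrow> \<exists>b\<in>B. mdist Z a b \<le> D" "\<And>b. b \<in> B \<Longrightarrow> \<exists>a\<in>A. mdist Z a b \<le> D"
  shows "hausdorff_dist Z A B \<le> ennreal D"
  unfolding hausdorff_dist_def using assms
  by (intro max.boundedI SUP_least) (meson INF_lower2 ennreal_leI)+

text \<open>The glued space contains isometric copies of \<open>X\<close> and \<open>Y\<close> at
  Hausdorff distance at most 2C: \<open>x\<close> is matched with \<open>f x\<close>, and
  \<open>y\<close> with a point whose image is within \<open>C\<close> of it.\<close>

lemma gh_dist_less_top_if_roughly_isometric:
  fixes X :: "'a metric" and Y :: "'b metric"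
  assumes "roughly_isometric X Y" "mspace X \<noteq> {}"
  shows "gh_dist X Y < \<infinity>"
proof -
  obtain C f where f: "rough_isometry C X Y f" using assms unfolding roughly_isometric_def by blast
  then have C: "C > 0" and fY: "\<And>x. x \<in> mspace X \<Longrightarrow> f x \<in> mspace Y"
    and dense: "\<And>y. y \<in> mspace Y \<Longrightarrow> \<exists>x\<in>mspace X. mdist Y (f x) y \<le> C"
    unfolding rough_isometry_def by auto
  interpret W: Metric_space "Inl ` mspace X \<union> Inr ` mspace Y" "glue_dist C X Y f"
    using f assms(2) by (rule Metric_space_glue_dist)
  define W where "W = metric (Inl ` mspace X \<union> Inr ` mspace Y, glue_dist C X Y f)"
  have W: "mspace W = Inl ` mspace X \<union> Inr ` mspace Y" "mdist W = glue_dist C X Y f"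
    by (simp_all add: W_def)
  have isoX: "isometric (submetric W (Inl ` mspace X)) X" unfolding isometric_def
    by (intro exI[of _ projl]) (auto simp: W bij_betw_def inj_on_def image_Un image_image Int_Un_distrib)
  have isoY: "isometric (submetric W (Inr ` mspace Y)) Y" unfolding isometric_def
    by (intro exI[of _ projr]) (auto simp: W bij_betw_def inj_on_def image_Un image_image Int_Un_distrib)
  \<comment> \<open>Crossing at \<open>p = x\<close> costs \<open>0 + C\<close> plus a distance of
    at most \<open>C\<close>.\<close>
  have near: "mdist W (Inl x) (Inr y) \<le> 2 * C"
    if "x \<in> mspace X" "mdist Y (f x) y \<le> C" for x y
  proof -
    have "mdist X x x = 0" using that(1) by simp
    then show ?thesis using bridge_dist_le[OF C that(1), of Y f x y] that(2) by (simp add: W)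
  qed
  have "hausdorff_dist W (Inl ` mspace X) (Inr ` mspace Y) \<le> ennreal (2 * C)"
  proof (rule hausdorff_dist_le)
    fix a :: "'a + 'b" assume "a \<in> Inl ` mspace X"
    then obtain x where x: "x \<in> mspace X" "a = Inl x" by auto
    have "mdist W a (Inr (f x)) \<le> 2 * C"
    proof -
      have "mdist Y (f x) (f x) = 0" using fY[OF x(1)] by simp
      then show ?thesis using near[OF x(1), of "f x"] x(2) C by simp
    qed
    then show "\<exists>b\<in>Inr ` mspace Y. mdist W a b \<le> 2 * C" using fY[OF x(1)] by blast
  next
    fix b :: "'a + 'b" assume "b \<in> Inr ` mspace Y"
    then show "\<exists>a\<in>Inl ` mspace X. mdist W a b \<le> 2 * C" using dense near by blast
  qed
  moreover have "gh_dist X Y \<le> hausdorff_dist W (Inl ` mspace X) (Inr ` mspace Y)"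
    by (rule gh_dist_le[OF _ _ isoX isoY]) (auto simp: W)
  ultimately have "gh_dist X Y \<le> ennreal (2 * C)" by (rule order_trans[rotated])
  then show ?thesis by (simp add: le_less_trans[OF _ ennreal_less_top])
qed

section \<open>Clouds in terms of rough isometry, and independence of the representative\<close>

lemma gh_dist_less_top_iff:
  assumes "mspace X \<noteq> {}"
  shows "gh_dist X Y < \<infinity> \<longleftrightarrow> roughly_isometric X Y"
  using assms roughly_isometric_if_gh_dist_less_top gh_dist_less_top_if_roughly_isometric by blast

lemma mem_cloud_iff:
  assumes "mspace Z \<noteq> {}"
  shows "X \<in> cloud Z \<longleftrightarrow> mspace X \<noteq> {} \<and> roughly_isometric Z X"
  unfolding cloud_def by (simp only: mem_Collect_eq gh_dist_less_top_iff[OF assms])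

text \<open>\<open>X\<close> and \<open>Y\<close> are linked through \<open>Z\<close>, so the scaled
  spaces are roughly isometric too, and \<open>Z\<close> reaches \<open>scale_metric l Y\<close>
  through \<open>scale_metric l X\<close>. The statement is polymorphic in both point types, so
  exchanging \<open>X\<close> and \<open>Y\<close> yields the opposite inclusion.\<close>

lemma Lambda_subset:
  assumes Z: "mspace Z \<noteq> {}" and "X \<in> cloud Z" "Y \<in> cloud Z"
  shows "Lambda Z X \<subseteq> Lambda Z Y"
proof
  fix l assume "l \<in> Lambda Z X"
  then have l: "l > 0" and lX: "roughly_isometric Z (scale_metric l X)"
    by (auto simp: Lambda_def mem_cloud_iff[OF Z])
  have "roughly_isometric X Y"
    using assms(2,3) unfolding mem_cloud_iff[OF Z] by (meson roughly_isometric_sym roughly_isometric_trans)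
  then have "roughly_isometric Z (scale_metric l Y)"
    using lX l by (meson roughly_isometric_scale roughly_isometric_trans)
  then show "l \<in> Lambda Z Y" using l assms(3) by (simp add: Lambda_def mem_cloud_iff[OF Z])
qed

theorem proposition3p2:
  fixes Z :: "'z metric" and X :: "'a metric" and Y :: "'b metric"
  assumes "mspace Z \<noteq> {}"
    and "X \<in> cloud Z" and "Y \<in> cloud Z"
  shows "Lambda Z X = Lambda Z Y"
  using assms by (intro equalityI Lambda_subset)

end
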